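(* Let $\{S_t\}_{t\ge0}$ be a weighted translation semigroup on $L^2(\mathbb R_+)$ with symbol $\varphi\in C^2$. If $\{S_t\}$ is 2-hyperexpansive, then its Cauchy dual $\{S_t'\}$ is a hyponormal contraction (that is, every $S_t'$, $t\in\mathbb R_+$, is a hyponormal operator and a contraction).
   Context: $\mathbb R_+=[0,\infty)$, and $L^2(\mathbb R_+)$ is the Hilbert space of complex-valued square-integrable Lebesgue measurable functions on $\mathbb R_+$. A symbol is a continuous, strictly positive function $\varphi:\mathbb R_+\to(0,\infty)$ such that for every $t\in\mathbb R_+$ the weight function $\varphi_t(x)=\sqrt{\varphi(x)/\varphi(x-t)}$ for $x\ge t$, $\varphi_t(x)=0$ for $x<t$, is essentially bounded. The weighted translation semigroup with symbol $\varphi$ is the family $\{S_t:t\in\mathbb R_+\}$ of bounded operators on $L^2(\mathbb R_+)$ given by $S_tf(x)=\varphi_t(x)f(x-t)$ for $x\ge t$ and $S_tf(x)=0$ for $x<t$. Derivatives at $0$ are one-sided. A bounded operator $T$ is 2-hyperexpansive if $I-T^*T\le0$ and $I-2T^*T+T^{*2}T^2\le0$; the semigroup $\{S_t\}$ is 2-hyperexpansive if every $S_t$ is. $T$ is hyponormal if $T^*T-TT^*\ge0$, and a contraction if $I-T^*T\ge0$. The Cauchy dual of a left invertible operator $T$ is $T'=T(T^*T)^{-1}$. If every $S_t$ is left invertible (which holds automatically when $\{S_t\}$ is 2-hyperexpansive, since then $S_t^*S_t\ge I$), the Cauchy dual of the semigroup $\{S_t\}$ is the family $\{S_t'\}$ with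 $S_t'=S_t(S_t^*S_t)^{-1}$; explicitly $S_t'f(x)=\frac{1}{\varphi_t(x)}f(x-t)$ for $x\ge t$ and $0$ for $x<t$. *)

theory Defs
  imports "HOL-Analysis.Analysis"
begin

section \<open>The Hilbert space of square-integrable functions on the half-line\<close>

definition square_integrable :: "(real \<Rightarrow> complex) \<Rightarrow> bool" where
  "square_integrable f \<longleftrightarrow>
     f \<in> borel_measurable (lebesgue_on {0..}) \<and>
     integrable (lebesgue_on {0..}) (\<lambda>x. (cmod (f x))\<^sup>2)"

text \<open>Only the values on \<open>[0,\<infinity>)\<close> matter: the measure \<open>lebesgue_on {0..}\<close> has space \<open>{0..}\<close>, so
  the relation below ignores what representatives do on the negative half-line.\<close>

definition L2_rel :: "(real \<Rightarrow> complex) \<Rightarrow> (real \<Rightarrow> complex) \<Rightarrow> bool" where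
  "L2_rel f g \<longleftrightarrow> square_integrable f \<and> square_integrable g \<and>
     (AE x in lebesgue_on {0..}. f x = g x)"

lemma square_integrable_zero: "square_integrable (\<lambda>x. 0)"
  by (simp add: square_integrable_def)

lemma square_integrable_cmult:
  assumes "square_integrable f"
  shows "square_integrable (\<lambda>x. c * f x)"
  using assms by (auto simp: square_integrable_def norm_mult power_mult_distrib)

lemma square_integrable_add:
  assumes f: "square_integrable f" and g: "square_integrable g"
  shows "square_integrable (\<lambda>x. f x + g x)"
proof -
  let ?M = "lebesgue_on {0..}"
  have m: "f \<in> borel_measurable ?M" "g \<in> borel_measurable ?M"
    using f g by (auto simp: square_integrable_def)
  have i: "integrable ?M (\<lambda>x. 2 * (cmod (f x))\<^sup>2 + 2 * (cmod (g x))\<^sup>2)"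
    using f g by (auto simp: square_integrable_def)
  have le: "(cmod (a + b))\<^sup>2 \<le> 2 * (cmod a)\<^sup>2 + 2 * (cmod b)\<^sup>2" for a b :: complex
  proof -
    have "(cmod (a + b))\<^sup>2 \<le> (cmod a + cmod b)\<^sup>2"
      by (intro power_mono norm_triangle_ineq norm_ge_zero)
    also have "\<dots> \<le> 2 * (cmod a)\<^sup>2 + 2 * (cmod b)\<^sup>2"
      using zero_le_power2[of "cmod a - cmod b"] by (simp add: power2_sum power2_diff)
    finally show ?thesis .
  qed
  have "integrable ?M (\<lambda>x. (cmod (f x + g x))\<^sup>2)"
    by (rule Bochner_Integration.integrable_bound[OF i]) (use m le in auto)
  then show ?thesis
    using m by (simp add: square_integrable_def)
qed

lemma integrable_mult_cnj:
  assumes f: "square_integrable f" and g: "square_integrable g"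
  shows "integrable (lebesgue_on {0..}) (\<lambda>x. f x * cnj (g x))"
proof -
  let ?M = "lebesgue_on {0..}"
  have m: "f \<in> borel_measurable ?M" "g \<in> borel_measurable ?M"
    using f g by (auto simp: square_integrable_def)
  have i: "integrable ?M (\<lambda>x. (cmod (f x))\<^sup>2 + (cmod (g x))\<^sup>2)"
    using f g by (auto simp: square_integrable_def)
  have cm: "(\<lambda>x. cnj (g x)) \<in> borel_measurable ?M"
    by (rule borel_measurable_continuous_on[OF _ m(2)]) (intro continuous_intros)
  have le: "cmod a * cmod b \<le> (cmod a)\<^sup>2 + (cmod b)\<^sup>2" for a b :: complex
    using sum_squares_bound[of "cmod a" "cmod b"] mult_nonneg_nonneg[of "cmod a" "cmod b"]
    by (simp del: mult_nonneg_nonneg)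
  show ?thesis
    by (rule Bochner_Integration.integrable_bound[OF i]) (use m cm le in \<open>auto simp: norm_mult\<close>)
qed

lemma L2_rel_I:
  assumes "square_integrable f" and "\<And>x. f x = g x"
  shows "L2_rel f g"
proof -
  have "f = g" using assms(2) by (rule ext)
  with assms(1) show ?thesis by (simp add: L2_rel_def)
qed

lemma L2_rel_part_equivp: "part_equivp L2_rel"
proof (rule part_equivpI)
  show "\<exists>f. L2_rel f f"
    using square_integrable_zero by (auto simp: L2_rel_def)
  show "symp L2_rel"
    by (auto simp: symp_def L2_rel_def elim!: eventually_mono)
  show "transp L2_rel"
    unfolding transp_def L2_rel_def by (auto elim: eventually_elim2)
qed

quotient_type L2 = "real \<Rightarrow> complex" / partial: L2_rel
  by (rule L2_rel_part_equivp)

lift_definition cscale :: "complex \<Rightarrow> L2 \<Rightarrow> L2" is "\<lambda>c f x. c * f x"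
  by (auto simp: L2_rel_def square_integrable_cmult elim!: eventually_mono)

text \<open>The inner product is linear in the first argument.\<close>

lift_definition cinner :: "L2 \<Rightarrow> L2 \<Rightarrow> complex" is
  "\<lambda>f g. integral\<^sup>L (lebesgue_on {0..}) (\<lambda>x. f x * cnj (g x))"
proof -
  fix f f' g g' :: "real \<Rightarrow> complex"
  assume f: "L2_rel f f'" and g: "L2_rel g g'"
  have m: "(\<lambda>x. f x * cnj (g x)) \<in> borel_measurable (lebesgue_on {0..})"
    "(\<lambda>x. f' x * cnj (g' x)) \<in> borel_measurable (lebesgue_on {0..})"
    using f g by (auto simp: L2_rel_def intro!: borel_measurable_integrable integrable_mult_cnj)
  have "AE x in lebesgue_on {0..}. f x * cnj (g x) = f' x * cnj (g' x)"
    using f g unfolding L2_rel_def by (auto elim!: eventually_elim2)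
  with m show "(LINT x|lebesgue_on {0..}. f x * cnj (g x)) =
      (LINT x|lebesgue_on {0..}. f' x * cnj (g' x))"
    by (rule integral_cong_AE)
qed

instantiation L2 :: real_vector
begin

lift_definition zero_L2 :: L2 is "\<lambda>x. 0"
  by (auto simp: L2_rel_def square_integrable_zero)

lift_definition plus_L2 :: "L2 \<Rightarrow> L2 \<Rightarrow> L2" is "\<lambda>f g x. f x + g x"
  unfolding L2_rel_def by (auto simp: square_integrable_add elim!: eventually_elim2)

definition uminus_L2 :: "L2 \<Rightarrow> L2" where "uminus_L2 f = cscale (-1) f"

definition minus_L2 :: "L2 \<Rightarrow> L2 \<Rightarrow> L2" where "minus_L2 f g = f + - g"

definition scaleR_L2 :: "real \<Rightarrow> L2 \<Rightarrow> L2" where "scaleR_L2 r f = cscale (of_real r) f"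

instance
proof
  fix f g h :: L2 and r s :: real
  note intros = square_integrable_add square_integrable_cmult square_integrable_zero
  show "f + g + h = f + (g + h)"
    by transfer (rule L2_rel_I, (intro intros; simp add: L2_rel_def), simp)
  show "f + g = g + f"
    by transfer (rule L2_rel_I, (intro intros; simp add: L2_rel_def), simp)
  show "0 + f = f"
    by transfer (simp add: L2_rel_def)
  show "- f + f = 0"
    unfolding uminus_L2_def
    by transfer (rule L2_rel_I, (intro intros; simp add: L2_rel_def), simp)
  show "f - g = f + - g"
    by (rule minus_L2_def)
  show "r *\<^sub>R (f + g) = r *\<^sub>R f + r *\<^sub>R g"
    unfolding scaleR_L2_def
    by transfer (rule L2_rel_I, (intro intros; simp add: L2_rel_def), simp add: distrib_left)
  show "(r + s) *\<^sub>R f = r *\<^sub>R f + s *\<^sub>R f"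
    unfolding scaleR_L2_def
    by transfer (rule L2_rel_I, (intro intros; simp add: L2_rel_def), simp add: distrib_right)
  show "r *\<^sub>R s *\<^sub>R f = (r * s) *\<^sub>R f"
    unfolding scaleR_L2_def
    by transfer (rule L2_rel_I, (intro intros; simp add: L2_rel_def), simp)
  show "1 *\<^sub>R f = f"
    unfolding scaleR_L2_def
    by transfer (simp add: L2_rel_def)
qed

end

lemma cinner_add_left: "cinner (f + g) h = cinner f h + cinner g h"
proof (transfer, goal_cases)
  case (1 f g h)
  then have "integrable (lebesgue_on {0..}) (\<lambda>x. f x * cnj (h x))"
    "integrable (lebesgue_on {0..}) (\<lambda>x. g x * cnj (h x))"
    by (auto simp: L2_rel_def intro!: integrable_mult_cnj)
  then show ?case by (simp add: distrib_right)
qed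

lemma cinner_cscale_left: "cinner (cscale c f) g = c * cinner f g"
  by transfer (simp add: mult.assoc)

lemma cinner_commute: "cinner f g = cnj (cinner g f)"
  by transfer (simp add: mult.commute del: Bochner_Integration.integral_cnj flip: Bochner_Integration.integral_cnj)

lemma cinner_self_eq_of_real:
  "square_integrable f \<Longrightarrow>
    (LINT x|lebesgue_on {0..}. f x * cnj (f x)) = of_real (LINT x|lebesgue_on {0..}. (cmod (f x))\<^sup>2)"
  by (simp add: complex_mult_cnj cmod_power2 flip: integral_complex_of_real)

instantiation L2 :: real_inner
begin

definition inner_L2 :: "L2 \<Rightarrow> L2 \<Rightarrow> real" where "inner_L2 f g = Re (cinner f g)"

definition norm_L2 :: "L2 \<Rightarrow> real" where "norm_L2 f = sqrt (inner f f)"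

definition dist_L2 :: "L2 \<Rightarrow> L2 \<Rightarrow> real" where "dist_L2 f g = norm (f - g)"

definition sgn_L2 :: "L2 \<Rightarrow> L2" where "sgn_L2 f = inverse (norm f) *\<^sub>R f"

definition uniformity_L2 :: "(L2 \<times> L2) filter" where
  "uniformity_L2 = (INF e\<in>{0 <..}. principal {(f, g). dist f g < e})"

definition open_L2 :: "L2 set \<Rightarrow> bool" where
  "open_L2 U \<longleftrightarrow> (\<forall>f\<in>U. eventually (\<lambda>(f', g). f' = f \<longrightarrow> g \<in> U) uniformity)"

instance
proof
  fix f g h :: L2 and r :: real and U :: "L2 set"
  show "dist f g = norm (f - g)" by (rule dist_L2_def)
  show "sgn f = f /\<^sub>R norm f" by (rule sgn_L2_def)
  show "uniformity = (INF e\<in>{0 <..}. principal {(f :: L2, g). dist f g < e})"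
    by (rule uniformity_L2_def)
  show "open U \<longleftrightarrow> (\<forall>f\<in>U. \<forall>\<^sub>F (f', g) in uniformity. f' = f \<longrightarrow> g \<in> U)"
    by (rule open_L2_def)
  show "inner f g = inner g f"
    unfolding inner_L2_def by (subst cinner_commute) simp
  show "inner (f + g) h = inner f h + inner g h"
    by (simp add: inner_L2_def cinner_add_left)
  show "inner (r *\<^sub>R f) g = r * inner f g"
    by (simp add: inner_L2_def scaleR_L2_def cinner_cscale_left)
  show "0 \<le> inner f f"
    unfolding inner_L2_def
    by transfer (simp add: L2_rel_def cinner_self_eq_of_real)
  show "inner f f = 0 \<longleftrightarrow> f = 0"
    unfolding inner_L2_def
  proof (transfer, goal_cases)
    case (1 f)
    then have f: "square_integrable f" by (simp add: L2_rel_def)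
    then have "(LINT x|lebesgue_on {0..}. (cmod (f x))\<^sup>2) = 0 \<longleftrightarrow>
        (AE x in lebesgue_on {0..}. (cmod (f x))\<^sup>2 = 0)"
      by (intro integral_nonneg_eq_0_iff_AE) (auto simp: square_integrable_def)
    with f show ?case
      by (simp add: L2_rel_def cinner_self_eq_of_real square_integrable_zero)
  qed
  show "norm f = sqrt (inner f f)" by (rule norm_L2_def)
qed

end


section \<open>Operators\<close>

definition bounded_operator :: "(L2 \<Rightarrow> L2) \<Rightarrow> bool" where
  "bounded_operator T \<longleftrightarrow>
     (\<forall>f g. T (f + g) = T f + T g) \<and>
     (\<forall>c f. T (cscale c f) = cscale c (T f)) \<and>
     (\<exists>K. \<forall>f. norm (T f) \<le> K * norm f)"

definition adj :: "(L2 \<Rightarrow> L2) \<Rightarrow> (L2 \<Rightarrow> L2)" where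
  "adj T = (THE A. \<forall>f g. cinner (T f) g = cinner f (A g))"

text \<open>A complex number lies in \<open>\<real>\<^sub>\<ge>\<^sub>0\<close> iff it is real and nonnegative.\<close>

definition positive_operator :: "(L2 \<Rightarrow> L2) \<Rightarrow> bool" where
  "positive_operator T \<longleftrightarrow> (\<forall>f. cinner (T f) f \<in> \<real>\<^sub>\<ge>\<^sub>0)"

definition operator_le :: "(L2 \<Rightarrow> L2) \<Rightarrow> (L2 \<Rightarrow> L2) \<Rightarrow> bool" where
  "operator_le A B \<longleftrightarrow> positive_operator (\<lambda>f. B f - A f)"

definition two_hyperexpansive :: "(L2 \<Rightarrow> L2) \<Rightarrow> bool" where
  "two_hyperexpansive T \<longleftrightarrow> bounded_operator T \<and>
     operator_le (\<lambda>f. f - (adj T \<circ> T) f) (\<lambda>f. 0) \<and>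
     operator_le (\<lambda>f. f - 2 *\<^sub>R (adj T \<circ> T) f + (adj T ^^ 2 \<circ> T ^^ 2) f) (\<lambda>f. 0)"

definition hyponormal :: "(L2 \<Rightarrow> L2) \<Rightarrow> bool" where
  "hyponormal T \<longleftrightarrow> bounded_operator T \<and>
     operator_le (\<lambda>f. 0) (\<lambda>f. (adj T \<circ> T) f - (T \<circ> adj T) f)"

definition contraction :: "(L2 \<Rightarrow> L2) \<Rightarrow> bool" where
  "contraction T \<longleftrightarrow> bounded_operator T \<and>
     operator_le (\<lambda>f. 0) (\<lambda>f. f - (adj T \<circ> T) f)"

text \<open>Meaningful for left invertible \<open>T\<close>, for which \<open>T\<^sup>* T\<close> is a bijection.\<close>

definition cauchy_dual :: "(L2 \<Rightarrow> L2) \<Rightarrow> (L2 \<Rightarrow> L2)" where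
  "cauchy_dual T = T \<circ> inv (adj T \<circ> T)"


section \<open>Weighted translation semigroups\<close>

definition weight :: "(real \<Rightarrow> real) \<Rightarrow> real \<Rightarrow> real \<Rightarrow> real" where
  "weight \<phi> t x = (if t \<le> x then sqrt (\<phi> x / \<phi> (x - t)) else 0)"

definition is_symbol :: "(real \<Rightarrow> real) \<Rightarrow> bool" where
  "is_symbol \<phi> \<longleftrightarrow> continuous_on {0..} \<phi> \<and> (\<forall>x\<ge>0. 0 < \<phi> x) \<and>
     (\<forall>t\<ge>0. \<exists>C. AE x in lebesgue_on {0..}. \<bar>weight \<phi> t x\<bar> \<le> C)"

text \<open>For a symbol \<open>\<phi>\<close> and \<open>t \<ge> 0\<close> the function below is square-integrable, and its class does not
  depend on the representative of \<open>f\<close>.\<close>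

definition translation_semigroup :: "(real \<Rightarrow> real) \<Rightarrow> real \<Rightarrow> L2 \<Rightarrow> L2" where
  "translation_semigroup \<phi> t f =
     abs_L2 (\<lambda>x. if t \<le> x then of_real (weight \<phi> t x) * rep_L2 f (x - t) else 0)"

text \<open>The derivatives within \<open>[0,\<infinity>)\<close> are one-sided at \<open>0\<close> and two-sided elsewhere.\<close>

definition C2_half_line :: "(real \<Rightarrow> real) \<Rightarrow> bool" where
  "C2_half_line \<phi> \<longleftrightarrow> (\<exists>\<phi>' \<phi>''.
     (\<forall>x\<ge>0. (\<phi> has_real_derivative \<phi>' x) (at x within {0..})) \<and>
     (\<forall>x\<ge>0. (\<phi>' has_real_derivative \<phi>'' x) (at x within {0..})) \<and>
     continuous_on {0..} \<phi>'')"

end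

theory Submission
  imports Defs
begin

text \<open>
  Everything reduces to multiplication operators. Put \<open>w = weight \<phi> t\<close>, so that
  \<open>w(x + t)\<^sup>2 = \<phi>(x + t) / \<phi>(x)\<close>. Then \<open>S\<^sub>t\<close> translates forward by \<open>t\<close> and multiplies by \<open>w\<close>,
  its adjoint multiplies by \<open>w\<close> and translates back, and hence \<open>S\<^sub>t\<^sup>* S\<^sub>t\<close> and
  \<open>S\<^sub>t\<^sup>*\<^sup>2 S\<^sub>t\<^sup>2\<close> are multiplication by \<open>\<phi>(x + t) / \<phi>(x)\<close> and \<open>\<phi>(x + 2t) / \<phi>(x)\<close>. A multiplication
  operator with continuous multiplier is positive only if the multiplier is nonnegative at every
  point. So 2-hyperexpansivity at \<open>t\<close> gives \<open>\<phi>(x) \<le> \<phi>(x + t)\<close> and the midpoint concavity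
  \<open>\<phi>(x) + \<phi>(x + 2t) \<le> 2 \<phi>(x + t)\<close> (lemma \<open>two_hyperexpansive_symbol\<close>).

  By monotonicity \<open>S\<^sub>t\<^sup>* S\<^sub>t\<close> has a bounded inverse, and the Cauchy dual is the weighted translation
  with weight \<open>1 / w\<close> (lemma \<open>induces_cauchy_dual\<close>). It is a contraction because
  \<open>\<phi>(x) / \<phi>(x + t) \<le> 1\<close>. For hyponormality, \<open>S\<^sub>t'\<^sup>* S\<^sub>t'\<close> is multiplication by
  \<open>\<phi>(x) / \<phi>(x + t)\<close>, while \<open>S\<^sub>t' S\<^sub>t'\<^sup>*\<close> is multiplication by \<open>\<phi>(x - t) / \<phi>(x)\<close> on \<open>x \<ge> t\<close> and by \<open>0\<close>
  below \<open>t\<close>. The required inequality \<open>\<phi>(x - t) \<phi>(x + t) \<le> \<phi>(x)\<^sup>2\<close> is concavity around the midpoint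
  \<open>x\<close> followed by the inequality of arithmetic and geometric means.

  Operators on equivalence classes are handled through the functions that they induce on
  square-integrable representatives (predicate \<open>induces\<close>); identities between operators then become
  pointwise identities on the half-line.
\<close>

section \<open>Classes and representatives\<close>

lemma L2_cases: obtains f where "square_integrable f" "F = abs_L2 f"
proof -
  have "L2_rel (rep_L2 F) (rep_L2 F)" "abs_L2 (rep_L2 F) = F"
    using Quotient_L2 by (rule Quotient_rep_reflp, rule Quotient_abs_rep)
  then show ?thesis
    using that[of "rep_L2 F"] by (simp add: L2_rel_def)
qed

lemma rep_abs_L2:
  assumes "square_integrable f"
  shows "square_integrable (rep_L2 (abs_L2 f))" "abs_L2 (rep_L2 (abs_L2 f)) = abs_L2 f"
proof -
  have "L2_rel f f" using assms by (simp add: L2_rel_def)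
  then show "square_integrable (rep_L2 (abs_L2 f))"
    using Quotient_rep_abs[OF Quotient_L2] by (simp add: L2_rel_def)
  show "abs_L2 (rep_L2 (abs_L2 f)) = abs_L2 f"
    by (rule Quotient_abs_rep[OF Quotient_L2])
qed

lemma square_integrable_cong:
  assumes "\<And>x. 0 \<le> x \<Longrightarrow> f x = g x"
  shows "square_integrable f \<longleftrightarrow> square_integrable g"
  unfolding square_integrable_def
  using assms by (intro conj_cong measurable_cong Bochner_Integration.integrable_cong) auto

lemma abs_L2_cong:
  assumes "square_integrable f" "\<And>x. 0 \<le> x \<Longrightarrow> f x = g x"
  shows "abs_L2 f = abs_L2 g"
proof -
  have "square_integrable g" using assms square_integrable_cong by blast
  moreover have "AE x in lebesgue_on {0..}. f x = g x"
    using assms by (intro AE_I2) auto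
  ultimately show ?thesis
    using assms(1) Quotient_rel_abs[OF Quotient_L2] by (simp add: L2_rel_def)
qed

lemma abs_L2_add:
  "square_integrable f \<Longrightarrow> square_integrable g \<Longrightarrow>
    abs_L2 f + abs_L2 g = abs_L2 (\<lambda>x. f x + g x)"
  by (simp add: plus_L2.abs_eq L2_rel_def)

lemma abs_L2_cscale: "square_integrable f \<Longrightarrow> cscale c (abs_L2 f) = abs_L2 (\<lambda>x. c * f x)"
  by (simp add: cscale.abs_eq L2_rel_def)

lemma abs_L2_scaleR:
  "square_integrable f \<Longrightarrow> r *\<^sub>R abs_L2 f = abs_L2 (\<lambda>x. of_real r * f x)"
  by (simp add: scaleR_L2_def abs_L2_cscale)

lemma square_integrable_diff:
  assumes "square_integrable f" "square_integrable g"
  shows "square_integrable (\<lambda>x. f x - g x)"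
  using square_integrable_add[OF assms(1) square_integrable_cmult[OF assms(2), of "-1"]] by simp

lemma abs_L2_diff:
  assumes "square_integrable f" "square_integrable g"
  shows "abs_L2 f - abs_L2 g = abs_L2 (\<lambda>x. f x - g x)"
  using abs_L2_add[OF assms(1) square_integrable_cmult[OF assms(2), of "-1"]]
  by (simp add: minus_L2_def uminus_L2_def abs_L2_cscale assms)

lemma cinner_abs_L2:
  "square_integrable f \<Longrightarrow> square_integrable g \<Longrightarrow>
    cinner (abs_L2 f) (abs_L2 g) = (LINT x|lebesgue_on {0..}. f x * cnj (g x))"
  by (simp add: cinner.abs_eq L2_rel_def)

lemma norm_abs_L2_power2:
  "square_integrable f \<Longrightarrow> (norm (abs_L2 f))\<^sup>2 = (LINT x|lebesgue_on {0..}. (cmod (f x))\<^sup>2)"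
  by (simp add: power2_norm_eq_inner inner_L2_def cinner_abs_L2 cinner_self_eq_of_real)

section \<open>Translation of integrals over the half-line\<close>

text \<open>Extending by zero turns integrals over the half-line into integrals over the whole line, where
  Lebesgue measure is translation invariant.\<close>

definition zero_ext :: "(real \<Rightarrow> 'a::zero) \<Rightarrow> real \<Rightarrow> 'a" where
  "zero_ext f x = (if 0 \<le> x then f x else 0)"

lemma integral_half_line:
  fixes f :: "real \<Rightarrow> 'a::{banach, second_countable_topology}"
  shows "(LINT x|lebesgue_on {0..}. f x) = (LINT x|lebesgue. zero_ext f x)"
    and "integrable (lebesgue_on {0..}) f \<longleftrightarrow> integrable lebesgue (zero_ext f)"
proof -
  have e: "zero_ext f = (\<lambda>x. indicator {0..} x *\<^sub>R f x)"
    by (auto simp: zero_ext_def)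
  show "(LINT x|lebesgue_on {0..}. f x) = (LINT x|lebesgue. zero_ext f x)"
    unfolding e by (subst integral_restrict_space) auto
  show "integrable (lebesgue_on {0..}) f \<longleftrightarrow> integrable lebesgue (zero_ext f)"
    unfolding e by (subst integrable_restrict_space) auto
qed

lemma measurable_half_line:
  fixes f :: "real \<Rightarrow> 'a::euclidean_space"
  shows "f \<in> borel_measurable (lebesgue_on {0..}) \<longleftrightarrow> zero_ext f \<in> borel_measurable lebesgue"
  using borel_measurable_if[of "{0::real..}" f] unfolding zero_ext_def[abs_def] by simp

lemma zero_ext_cmod_power2:
  "zero_ext (\<lambda>x. (cmod (f x))\<^sup>2) = (\<lambda>x. (cmod (zero_ext f x))\<^sup>2)"
  by (auto simp: zero_ext_def)

lemma borel_measurable_translation: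
  fixes h :: "real \<Rightarrow> 'a::euclidean_space"
  assumes "h \<in> borel_measurable lebesgue"
  shows "(\<lambda>x. h (x + c)) \<in> borel_measurable lebesgue"
proof -
  have "(\<lambda>x. c + x) \<in> lebesgue \<rightarrow>\<^sub>M lebesgue"
    using lebesgue_affine_measurable[where c= "\<lambda>x::real. 1" and t=c] by simp
  from measurable_compose[OF this assms] show ?thesis by (simp add: add.commute)
qed

lemma integral_translation:
  fixes h :: "real \<Rightarrow> 'a::euclidean_space"
  shows "(LINT x|lebesgue. h (x + c)) = (LINT x|lebesgue. h x)"
    and "integrable lebesgue (\<lambda>x. h (x + c)) \<longleftrightarrow> integrable lebesgue h"
  using lebesgue_integral_real_affine[of 1 h c] lebesgue_integrable_real_affine_iff[of 1 h c]
  by (simp_all add: add.commute)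

text \<open>This single estimate makes both weighted translations bounded: forward translation has
  \<open>c = - t\<close>, backward translation has \<open>c = t\<close>. The absolute value of \<open>C\<close> allows its sign to be
  left open.\<close>

lemma square_integrable_dominated:
  assumes f: "square_integrable f" and g: "g \<in> borel_measurable (lebesgue_on {0..})"
    and le: "\<And>x. cmod (zero_ext g x) \<le> C * cmod (zero_ext f (x + c))"
  shows "square_integrable g" "norm (abs_L2 g) \<le> \<bar>C\<bar> * norm (abs_L2 f)"
proof -
  have i: "integrable lebesgue (\<lambda>x. C\<^sup>2 * (cmod (zero_ext f (x + c)))\<^sup>2)"
    using f unfolding square_integrable_def integral_half_line
    by (simp add: zero_ext_cmod_power2 integral_translation(2)[of "\<lambda>x. (cmod (zero_ext f x))\<^sup>2"])
  have le2: "(cmod (zero_ext g x))\<^sup>2 \<le> C\<^sup>2 * (cmod (zero_ext f (x + c)))\<^sup>2" for x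
    using power_mono[OF le[of x], of 2] by (simp add: power_mult_distrib)
  have m: "zero_ext g \<in> borel_measurable lebesgue" using g measurable_half_line by blast
  have ig: "integrable lebesgue (\<lambda>x. (cmod (zero_ext g x))\<^sup>2)"
    by (rule Bochner_Integration.integrable_bound[OF i]) (use m le2 in auto)
  then show sg: "square_integrable g"
    using g unfolding square_integrable_def integral_half_line
    by (simp add: zero_ext_cmod_power2)
  have "(norm (abs_L2 g))\<^sup>2 \<le> (LINT x|lebesgue. C\<^sup>2 * (cmod (zero_ext f (x + c)))\<^sup>2)"
    unfolding norm_abs_L2_power2[OF sg] integral_half_line zero_ext_cmod_power2
    by (rule integral_mono[OF ig i le2])
  also have "\<dots> = C\<^sup>2 * (norm (abs_L2 f))\<^sup>2"
    unfolding norm_abs_L2_power2[OF f] integral_half_line zero_ext_cmod_power2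
    by (simp add: integral_translation(1)[of "\<lambda>x. (cmod (zero_ext f x))\<^sup>2"])
  also have "\<dots> = (\<bar>C\<bar> * norm (abs_L2 f))\<^sup>2" by (simp add: power_mult_distrib)
  finally show "norm (abs_L2 g) \<le> \<bar>C\<bar> * norm (abs_L2 f)"
    by (rule power2_le_imp_le) simp
qed

section \<open>Weighted translations of functions\<close>

definition bounded_weight :: "(real \<Rightarrow> real) \<Rightarrow> bool" where
  "bounded_weight w \<longleftrightarrow> w \<in> borel_measurable (lebesgue_on {0..}) \<and> (\<exists>C. \<forall>x\<ge>0. \<bar>w x\<bar> \<le> C)"

definition forward :: "(real \<Rightarrow> real) \<Rightarrow> real \<Rightarrow> (real \<Rightarrow> complex) \<Rightarrow> real \<Rightarrow> complex" where
  "forward w t f x = (if t \<le> x then of_real (w x) * f (x - t) else 0)"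

definition backward :: "(real \<Rightarrow> real) \<Rightarrow> real \<Rightarrow> (real \<Rightarrow> complex) \<Rightarrow> real \<Rightarrow> complex" where
  "backward w t f x = of_real (w (x + t)) * f (x + t)"

lemma forward_dominated:
  assumes w: "bounded_weight w" and t: "0 \<le> t"
  obtains C where "\<And>f. square_integrable f \<Longrightarrow> square_integrable (forward w t f)"
    "\<And>f. square_integrable f \<Longrightarrow> norm (abs_L2 (forward w t f)) \<le> C * norm (abs_L2 f)"
proof -
  obtain C where C: "\<And>x. 0 \<le> x \<Longrightarrow> \<bar>w x\<bar> \<le> C" using w by (auto simp: bounded_weight_def)
  have C0: "0 \<le> C" using C[of 0] by auto
  have ext: "zero_ext (forward w t f) = (\<lambda>x. of_real (zero_ext w x) * zero_ext f (x + (- t)))" for f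
    using t by (auto simp: zero_ext_def forward_def)
  have le: "cmod (zero_ext (forward w t f) x) \<le> C * cmod (zero_ext f (x + (- t)))" for f x
  proof -
    have "\<bar>zero_ext w x\<bar> \<le> C" using C[of x] C0 by (simp add: zero_ext_def)
    then show ?thesis unfolding ext by (simp add: norm_mult mult_right_mono)
  qed
  have m: "forward w t f \<in> borel_measurable (lebesgue_on {0..})" if "square_integrable f" for f
  proof -
    have "zero_ext f \<in> borel_measurable lebesgue" "zero_ext w \<in> borel_measurable lebesgue"
      using that w unfolding square_integrable_def bounded_weight_def measurable_half_line by auto
    from this(2) borel_measurable_translation[OF this(1), of "- t"]
    show ?thesis unfolding measurable_half_line ext by measurable
  qed
  from square_integrable_dominated[OF _ m le] C0 show ?thesis
    by (intro that[of C]) auto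
qed

lemma backward_dominated:
  assumes w: "bounded_weight w" and t: "0 \<le> t"
  obtains C where "\<And>f. square_integrable f \<Longrightarrow> square_integrable (backward w t f)"
    "\<And>f. square_integrable f \<Longrightarrow> norm (abs_L2 (backward w t f)) \<le> C * norm (abs_L2 f)"
proof -
  obtain C where C: "\<And>x. 0 \<le> x \<Longrightarrow> \<bar>w x\<bar> \<le> C" using w by (auto simp: bounded_weight_def)
  have C0: "0 \<le> C" using C[of 0] by auto
  have ext: "zero_ext (backward w t f) =
      (\<lambda>x. indicator {0..} x *\<^sub>R (of_real (zero_ext w (x + t)) * zero_ext f (x + t)))" for f
    using t by (auto simp: zero_ext_def backward_def)
  have le: "cmod (zero_ext (backward w t f) x) \<le> C * cmod (zero_ext f (x + t))" for f x
  proof -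
    have "\<bar>zero_ext w (x + t)\<bar> \<le> C" using C[of "x + t"] C0 by (simp add: zero_ext_def)
    then show ?thesis unfolding ext using C0
      by (auto simp add: norm_mult mult_right_mono indicator_def)
  qed
  have m: "backward w t f \<in> borel_measurable (lebesgue_on {0..})" if "square_integrable f" for f
  proof -
    have "zero_ext f \<in> borel_measurable lebesgue" "zero_ext w \<in> borel_measurable lebesgue"
      using that w unfolding square_integrable_def bounded_weight_def measurable_half_line by auto
    note this[THEN borel_measurable_translation, of t]
    then show ?thesis
      unfolding measurable_half_line ext
      by (intro borel_measurable_scaleR borel_measurable_indicator borel_measurable_times
          borel_measurable_of_real) auto
  qed
  from square_integrable_dominated[OF _ m le] C0 show ?thesis
    by (intro that[of C]) auto
qed

text \<open>Substitute \<open>x + t\<close> for \<open>x\<close>: the integrand on the left vanishes on \<open>[0, t)\<close>, so nothing is lost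
  when its translate is cut off at \<open>0\<close>.\<close>

lemma forward_adjoint:
  assumes t: "0 \<le> t"
  shows "(LINT x|lebesgue_on {0..}. forward w t f x * cnj (g x)) =
    (LINT x|lebesgue_on {0..}. f x * cnj (backward w t g x))"
proof -
  have "zero_ext (\<lambda>x. f x * cnj (backward w t g x)) =
      (\<lambda>x. zero_ext (\<lambda>x. forward w t f x * cnj (g x)) (x + t))"
    using t by (auto simp: zero_ext_def forward_def backward_def)
  then show ?thesis
    unfolding integral_half_line by (simp only: integral_translation)
qed

section \<open>Operators induced on classes\<close>

definition induces :: "((real \<Rightarrow> complex) \<Rightarrow> real \<Rightarrow> complex) \<Rightarrow> (L2 \<Rightarrow> L2) \<Rightarrow> bool" where
  "induces A T \<longleftrightarrow>
    (\<forall>f. square_integrable f \<longrightarrow> square_integrable (A f) \<and> T (abs_L2 f) = abs_L2 (A f))"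

lemma inducesD:
  "induces A T \<Longrightarrow> square_integrable f \<Longrightarrow> square_integrable (A f)"
  "induces A T \<Longrightarrow> square_integrable f \<Longrightarrow> T (abs_L2 f) = abs_L2 (A f)"
  by (simp_all add: induces_def)

lemma induces_comp: "induces A T \<Longrightarrow> induces B U \<Longrightarrow> induces (A \<circ> B) (T \<circ> U)"
  by (simp add: induces_def)

lemma induces_cong:
  assumes "induces A T" "\<And>f x. 0 \<le> x \<Longrightarrow> A f x = B f x"
  shows "induces B T"
  using assms abs_L2_cong square_integrable_cong unfolding induces_def by metis

lemma induces_unique: "induces A T \<Longrightarrow> induces A U \<Longrightarrow> T = U"
  by (rule ext) (metis L2_cases inducesD(2))

lemma forward_bounded_operator:
  assumes "bounded_weight w" "0 \<le> t" "induces (forward w t) T"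
  shows "bounded_operator T"
proof -
  obtain C where C: "\<And>f. square_integrable f \<Longrightarrow>
      norm (abs_L2 (forward w t f)) \<le> C * norm (abs_L2 f)"
    using forward_dominated[OF assms(1,2)] by metis
  have "T (F + G) = T F + T G" for F G
  proof (cases F rule: L2_cases, cases G rule: L2_cases)
    fix f g assume "square_integrable f" "square_integrable g" "F = abs_L2 f" "G = abs_L2 g"
    moreover have "forward w t (\<lambda>x. f x + g x) = (\<lambda>x. forward w t f x + forward w t g x)"
      by (auto simp: forward_def algebra_simps)
    ultimately show ?thesis
      by (simp add: abs_L2_add square_integrable_add inducesD[OF assms(3)])
  qed
  moreover have "T (cscale c F) = cscale c (T F)" for c F
  proof (cases F rule: L2_cases)
    fix f assume "square_integrable f" "F = abs_L2 f"
    moreover have "forward w t (\<lambda>x. c * f x) = (\<lambda>x. c * forward w t f x)"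
      by (auto simp: forward_def)
    ultimately show ?thesis
      by (simp add: abs_L2_cscale square_integrable_cmult inducesD[OF assms(3)])
  qed
  moreover have "norm (T F) \<le> C * norm F" for F
    by (cases F rule: L2_cases) (simp add: C inducesD[OF assms(3)])
  ultimately show ?thesis unfolding bounded_operator_def by blast
qed

text \<open>The defining condition of the adjoint determines it, because an element of an inner product
  space is determined by its inner products. Thus the description operator in the definition of
  the adjoint can be resolved by exhibiting a candidate.\<close>

lemma adj_eqI:
  assumes "\<And>f g. cinner (T f) g = cinner f (A g)"
  shows "adj T = A"
  unfolding adj_def
proof (rule the_equality)
  fix B assume B: "\<forall>f g. cinner (T f) g = cinner f (B g)"
  show "B = A"
  proof
    fix g
    have "inner f (B g) = inner f (A g)" for f
      using assms B by (metis inner_L2_def)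
    then show "B g = A g" by (metis vector_eq_ldot)
  qed
qed (use assms in blast)

text \<open>Choosing a representative costs nothing: two representatives of a class differ by a function of
  norm zero, and additivity together with the norm bound forces their images to agree as well. This
  avoids arguing with translates of null sets.\<close>

lemma induces_rep:
  assumes "\<And>f g x. A (\<lambda>x. f x - g x) x = A f x - A g x"
    and C: "\<And>f. square_integrable f \<Longrightarrow> square_integrable (A f)"
    "\<And>f. square_integrable f \<Longrightarrow> norm (abs_L2 (A f)) \<le> C * norm (abs_L2 f)"
  shows "induces A (\<lambda>F. abs_L2 (A (rep_L2 F)))"
  unfolding induces_def
proof (intro allI impI conjI)
  fix f assume f: "square_integrable f"
  show "square_integrable (A f)" by (rule C(1)[OF f])
  define g where "g = rep_L2 (abs_L2 f)"
  have g: "square_integrable g" "abs_L2 g = abs_L2 f"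
    unfolding g_def by (rule rep_abs_L2[OF f])+
  have "A (\<lambda>x. g x - f x) = (\<lambda>x. A g x - A f x)"
    using assms(1) by blast
  then have "norm (abs_L2 (A g) - abs_L2 (A f)) \<le> C * norm (abs_L2 g - abs_L2 f)"
    using C(2)[of "\<lambda>x. g x - f x"]
    by (simp add: abs_L2_diff f g(1) C(1) square_integrable_diff)
  then show "abs_L2 (A (rep_L2 (abs_L2 f))) = abs_L2 (A f)"
    using g(2) by (simp add: g_def)
qed

lemma induces_forward_rep:
  assumes "bounded_weight w" "0 \<le> t"
  shows "induces (forward w t) (\<lambda>F. abs_L2 (forward w t (rep_L2 F)))"
proof -
  obtain C where "\<And>f. square_integrable f \<Longrightarrow> square_integrable (forward w t f)"
    "\<And>f. square_integrable f \<Longrightarrow> norm (abs_L2 (forward w t f)) \<le> C * norm (abs_L2 f)"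
    using forward_dominated[OF assms] by metis
  then show ?thesis
    by (intro induces_rep) (auto simp: forward_def algebra_simps)
qed

lemma induces_adj:
  assumes "bounded_weight w" "0 \<le> t" "induces (forward w t) T"
  shows "induces (backward w t) (adj T)"
proof -
  define B where "B = (\<lambda>F. abs_L2 (backward w t (rep_L2 F)))"
  obtain C where "\<And>f. square_integrable f \<Longrightarrow> square_integrable (backward w t f)"
    "\<And>f. square_integrable f \<Longrightarrow> norm (abs_L2 (backward w t f)) \<le> C * norm (abs_L2 f)"
    using backward_dominated[OF assms(1,2)] by metis
  then have B: "induces (backward w t) B"
    unfolding B_def by (intro induces_rep) (auto simp: backward_def algebra_simps)
  have "adj T = B"
  proof (rule adj_eqI)
    fix F G
    show "cinner (T F) G = cinner F (B G)"
      by (cases F rule: L2_cases, cases G rule: L2_cases)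
        (simp add: inducesD[OF assms(3)] inducesD[OF B] cinner_abs_L2 forward_adjoint[OF assms(2)])
  qed
  with B show ?thesis by simp
qed

lemma induces_zero: "induces (\<lambda>f x. 0) (\<lambda>F. 0)"
  by (simp add: induces_def square_integrable_zero zero_L2.abs_eq)

lemma induces_id: "induces (\<lambda>f. f) (\<lambda>F. F)"
  by (simp add: induces_def)

lemma induces_diff:
  "induces A T \<Longrightarrow> induces B U \<Longrightarrow> induces (\<lambda>f x. A f x - B f x) (\<lambda>F. T F - U F)"
  by (simp add: induces_def square_integrable_diff abs_L2_diff)

lemma induces_add:
  "induces A T \<Longrightarrow> induces B U \<Longrightarrow> induces (\<lambda>f x. A f x + B f x) (\<lambda>F. T F + U F)"
  by (simp add: induces_def square_integrable_add abs_L2_add)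

lemma induces_scaleR:
  "induces A T \<Longrightarrow> induces (\<lambda>f x. of_real r * A f x) (\<lambda>F. r *\<^sub>R T F)"
  by (simp add: induces_def square_integrable_cmult abs_L2_scaleR)

section \<open>Positivity of multiplication operators\<close>

lemma cinner_multiplication:
  assumes "induces (\<lambda>f x. of_real (p x) * f x) D" "square_integrable f"
  shows "integrable (lebesgue_on {0..}) (\<lambda>x. p x * (cmod (f x))\<^sup>2)"
    and "cinner (D (abs_L2 f)) (abs_L2 f) = of_real (LINT x|lebesgue_on {0..}. p x * (cmod (f x))\<^sup>2)"
proof -
  have e: "of_real (p x) * f x * cnj (f x) = complex_of_real (p x * (cmod (f x))\<^sup>2)" for x
    by (simp only: complex_norm_square of_real_mult mult.assoc)
  have "integrable (lebesgue_on {0..}) (\<lambda>x. complex_of_real (p x * (cmod (f x))\<^sup>2))"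
    using integrable_mult_cnj[OF inducesD(1)[OF assms] assms(2)] by (simp only: e)
  then show "integrable (lebesgue_on {0..}) (\<lambda>x. p x * (cmod (f x))\<^sup>2)"
    using complex_of_real_integrable_eq by blast
  show "cinner (D (abs_L2 f)) (abs_L2 f) = of_real (LINT x|lebesgue_on {0..}. p x * (cmod (f x))\<^sup>2)"
    by (simp only: inducesD[OF assms] cinner_abs_L2 assms(2) e integral_complex_of_real)
qed

lemma positive_multiplicationI:
  assumes "induces (\<lambda>f x. of_real (p x) * f x) D" "\<And>x. 0 \<le> x \<Longrightarrow> 0 \<le> p x"
  shows "positive_operator D"
  unfolding positive_operator_def
proof
  fix F
  obtain f where f: "square_integrable f" "F = abs_L2 f" by (rule L2_cases)
  have "0 \<le> (LINT x|lebesgue_on {0..}. p x * (cmod (f x))\<^sup>2)"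
    using assms(2) by (intro integral_nonneg_AE AE_I2) auto
  then show "cinner (D F) F \<in> \<real>\<^sub>\<ge>\<^sub>0"
    by (simp add: f(2) cinner_multiplication(2)[OF assms(1) f(1)])
qed

text \<open>If the multiplier were negative at \<open>x\<close>, continuity would keep it below \<open>p x / 2\<close> on a short
  interval to the right of \<open>x\<close>, and the indicator of that interval would have a negative quadratic
  form. Going to the right keeps the interval inside the half-line, also for \<open>x = 0\<close>.\<close>

lemma positive_multiplicationD:
  assumes D: "induces (\<lambda>f x. of_real (p x) * f x) D" "positive_operator D"
    and p: "continuous_on {0..} p" and x: "0 \<le> x"
  shows "0 \<le> p x"
proof (rule ccontr)
  assume neg: "\<not> 0 \<le> p x"
  then obtain d where d: "0 < d" "\<And>y. y \<in> {0..} \<Longrightarrow> dist y x < d \<Longrightarrow> dist (p y) (p x) < - p x / 2"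
    using p x unfolding continuous_on_iff by (metis atLeast_iff half_gt_zero neg_0_less_iff_less not_le)
  define I where "I = {x..x + d / 2}"
  define f where "f = (\<lambda>y. indicator I y :: complex)"
  have le: "p y \<le> p x / 2" if "y \<in> I" for y
    using d(2)[of y] that x d(1) neg unfolding I_def by (auto simp: dist_real_def abs_if split: if_splits)
  have sub: "I \<subseteq> {0..}" using x by (auto simp: I_def)
  have meas: "measure (lebesgue_on {0..}) I = d / 2"
    using sub d(1) by (subst measure_restrict_space) (auto simp: I_def)
  have ii: "integrable (lebesgue_on {0..}) (indicator I :: real \<Rightarrow> real)"
    using sub unfolding integrable_restrict_space[of "{0::real..}" lebesgue, simplified]
    by (auto simp: I_def simp flip: indicator_inter_arith lmeasurable_iff_integrable)
  have c: "(cmod (f y))\<^sup>2 = indicator I y" for y by (auto simp: f_def indicator_def)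
  have f: "square_integrable f"
    using ii sub unfolding square_integrable_def c
    by (auto simp: f_def I_def sets_restrict_space_iff intro!: borel_measurable_indicator)
  have "0 \<le> (LINT y|lebesgue_on {0..}. p y * indicator I y)"
    using D(2)[unfolded positive_operator_def, rule_format, of "abs_L2 f"]
    unfolding cinner_multiplication(2)[OF D(1) f] nonneg_Reals_of_real_iff c .
  also have "\<dots> \<le> (LINT y|lebesgue_on {0..}. p x / 2 * indicator I y)"
  proof (rule integral_mono)
    show "integrable (lebesgue_on {0..}) (\<lambda>y. p y * indicator I y)"
      using cinner_multiplication(1)[OF D(1) f] by (simp only: c)
    show "integrable (lebesgue_on {0..}) (\<lambda>y. p x / 2 * indicator I y)"
      using ii by (rule integrable_mult_right)
  qed (use le in \<open>auto simp: indicator_def\<close>)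
  also have "\<dots> = p x / 2 * (d / 2)"
    using sub meas by (simp add: Int_absorb2)
  also have "\<dots> < 0" using neg d(1) by (simp add: mult_neg_pos)
  finally show False by simp
qed

section \<open>The weights of a symbol\<close>

text \<open>The points where \<open>m\<close> is negative inside \<open>(a, \<infinity>)\<close> form an open null set, which must be empty;
  the endpoint follows by continuity.\<close>

lemma AE_nonneg_half_line:
  fixes m :: "real \<Rightarrow> real"
  assumes m: "continuous_on {a..} m" and AE: "AE x in lebesgue. a \<le> x \<longrightarrow> 0 \<le> m x" and x: "a \<le> x"
  shows "0 \<le> m x"
proof -
  define U where "U = {a<..} \<inter> m -` {..<0}"
  have "open U"
    unfolding U_def by (intro continuous_open_preimage continuous_on_subset[OF m]) auto
  moreover have "AE x\<in>U in lebesgue. x \<in> {}"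
    using AE by eventually_elim (auto simp: U_def)
  ultimately have "U = {}"
    using mem_closed_if_AE_lebesgue_open[of U "{}"] by blast
  then have pos: "0 \<le> m y" if "y \<in> {a<..}" for y
    using that by (force simp: U_def)
  show ?thesis
    using continuous_ge_on_closure[of "{a<..}" m x 0] m x pos by auto
qed

lemma weight_power2: "is_symbol \<phi> \<Longrightarrow> 0 \<le> t \<Longrightarrow> 0 \<le> x \<Longrightarrow> (weight \<phi> t (x + t))\<^sup>2 = \<phi> (x + t) / \<phi> x"
  by (simp add: weight_def is_symbol_def less_imp_le)

lemma continuous_on_quotient:
  assumes "is_symbol \<phi>" "0 \<le> s"
  shows "continuous_on {0..} (\<lambda>x. \<phi> (x + s) / \<phi> x)"
proof -
  have c: "continuous_on {0..} \<phi>" and p: "\<And>x. 0 \<le> x \<Longrightarrow> 0 < \<phi> x"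
    using assms by (auto simp: is_symbol_def)
  have "continuous_on {0..} (\<lambda>x. \<phi> (x + s))"
    by (rule continuous_on_compose2[OF c]) (use assms in \<open>auto intro!: continuous_intros\<close>)
  then show ?thesis
    using p by (intro continuous_on_divide c) (auto simp: less_imp_neq[symmetric])
qed

lemma weight_continuous:
  assumes "is_symbol \<phi>" "0 \<le> t"
  shows "continuous_on {t..} (weight \<phi> t)"
proof -
  have "continuous_on {t..} (\<lambda>x. sqrt (\<phi> ((x - t) + t) / \<phi> (x - t)))"
    by (intro continuous_on_compose2[OF continuous_on_quotient[OF assms]] continuous_intros) auto
  then show ?thesis
    by (rule continuous_on_eq) (simp add: weight_def)
qed

lemma measurable_half_lineI:
  fixes w :: "real \<Rightarrow> real"
  assumes "continuous_on {t..} w" "\<And>x. x < t \<Longrightarrow> w x = 0"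
  shows "w \<in> borel_measurable (lebesgue_on {0..})"
proof -
  have "w \<in> borel_measurable (lebesgue_on {t..})"
    using assms(1) by (intro continuous_imp_measurable_on_sets_lebesgue) auto
  then have "(\<lambda>x. if x \<in> {t..} then w x else 0) \<in> borel_measurable lebesgue"
    using borel_measurable_if[of "{t..}" w] by simp
  moreover have "(\<lambda>x. if x \<in> {t..} then w x else 0) = w" using assms(2) by auto
  ultimately show ?thesis by (auto intro: measurable_restrict_space1)
qed

text \<open>The definition of a symbol bounds the weight only almost everywhere. A bound at every point
  survives translation of the argument without exceptional sets, and continuity supplies it.\<close>

lemma bounded_weight_weight:
  assumes \<phi>: "is_symbol \<phi>" and t: "0 \<le> t"
  shows "bounded_weight (weight \<phi> t)"
proof -
  obtain C where "AE x in lebesgue_on {0..}. \<bar>weight \<phi> t x\<bar> \<le> C"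
    using \<phi> t by (auto simp: is_symbol_def)
  then have "AE x in lebesgue. 0 \<le> x \<longrightarrow> \<bar>weight \<phi> t x\<bar> \<le> C"
    by (subst (asm) AE_restrict_space_iff) auto
  then have AE: "AE x in lebesgue. t \<le> x \<longrightarrow> 0 \<le> C - \<bar>weight \<phi> t x\<bar>"
    by eventually_elim (use t in auto)
  have "\<bar>weight \<phi> t x\<bar> \<le> C" if "t \<le> x" for x
    using AE_nonneg_half_line[OF continuous_on_diff[OF continuous_on_const
        continuous_on_rabs[OF weight_continuous[OF assms]]] AE that] by simp
  then have "\<bar>weight \<phi> t x\<bar> \<le> max 0 C" for x
    by (cases "t \<le> x") (simp_all add: weight_def max.coboundedI2)
  moreover have "weight \<phi> t \<in> borel_measurable (lebesgue_on {0..})"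
    using weight_continuous[OF assms] by (rule measurable_half_lineI) (simp add: weight_def)
  ultimately show ?thesis unfolding bounded_weight_def by blast
qed

lemma induces_translation_semigroup:
  assumes "is_symbol \<phi>" "0 \<le> t"
  shows "induces (forward (weight \<phi> t) t) (translation_semigroup \<phi> t)"
  using induces_forward_rep[OF bounded_weight_weight[OF assms] assms(2)]
  unfolding translation_semigroup_def[abs_def] forward_def[abs_def] .

lemma induces_adj_comp:
  assumes "bounded_weight w" "0 \<le> t" "induces (forward w t) T"
  shows "induces (\<lambda>f x. of_real ((w (x + t))\<^sup>2) * f x) (adj T \<circ> T)"
  using induces_comp[OF induces_adj[OF assms] assms(3)]
  by (rule induces_cong) (simp add: forward_def backward_def power2_eq_square)

section \<open>2-hyperexpansivity and the Cauchy dual\<close>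

text \<open>The two defining inequalities of 2-hyperexpansivity say that multiplication by
  \<open>\<phi>(x + t) / \<phi>(x) - 1\<close> and by \<open>2 \<phi>(x + t) / \<phi>(x) - 1 - \<phi>(x + 2t) / \<phi>(x)\<close> are positive
  operators.\<close>

lemma two_hyperexpansive_symbol:
  assumes \<phi>: "is_symbol \<phi>" and t: "0 \<le> t" and x: "0 \<le> x"
    and S: "two_hyperexpansive (translation_semigroup \<phi> t)"
  shows "\<phi> x \<le> \<phi> (x + t)" and "\<phi> x + \<phi> (x + 2 * t) \<le> 2 * \<phi> (x + t)"
proof -
  define T where "T = translation_semigroup \<phi> t"
  define w where "w = weight \<phi> t"
  have pos: "0 < \<phi> x" if "0 \<le> x" for x using \<phi> that by (simp add: is_symbol_def)
  have w: "bounded_weight w" unfolding w_def by (rule bounded_weight_weight[OF \<phi> t])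
  have T: "induces (forward w t) T"
    unfolding w_def T_def by (rule induces_translation_semigroup[OF \<phi> t])
  have sq: "(w (x + t))\<^sup>2 = \<phi> (x + t) / \<phi> x" if "0 \<le> x" for x
    unfolding w_def by (rule weight_power2[OF \<phi> t that])
  have 1: "induces (\<lambda>f x. of_real (\<phi> (x + t) / \<phi> x) * f x) (adj T \<circ> T)"
    using induces_adj_comp[OF w t T] by (rule induces_cong) (simp only: sq)
  have 2: "induces (\<lambda>f x. of_real (\<phi> (x + 2 * t) / \<phi> x) * f x) (adj T ^^ 2 \<circ> T ^^ 2)"
  proof -
    \<comment> \<open>The inner factor is already a multiplication, so only one more pair of translations
      has to be evaluated.\<close>
    have e: "adj T ^^ 2 \<circ> T ^^ 2 = adj T \<circ> ((adj T \<circ> T) \<circ> T)"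
      by (auto simp: numeral_2_eq_2)
    show ?thesis unfolding e
    proof (rule induces_cong[OF induces_comp[OF induces_adj[OF w t T] induces_comp[OF 1 T]]])
      fix f :: "real \<Rightarrow> complex" and x :: real assume x: "0 \<le> x"
      have "(backward w t \<circ> ((\<lambda>f x. of_real (\<phi> (x + t) / \<phi> x) * f x) \<circ> forward w t)) f x
          = of_real (\<phi> (x + t + t) / \<phi> (x + t) * (w (x + t))\<^sup>2) * f x"
        using x t by (simp add: backward_def forward_def power2_eq_square mult_ac)
      also have "\<phi> (x + t + t) / \<phi> (x + t) * (w (x + t))\<^sup>2 = \<phi> (x + 2 * t) / \<phi> x"
        unfolding sq[OF x] using pos[of "x + t"] x t by (simp add: algebra_simps)
      finally show "(backward w t \<circ> ((\<lambda>f x. of_real (\<phi> (x + t) / \<phi> x) * f x) \<circ> forward w t)) f x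
          = of_real (\<phi> (x + 2 * t) / \<phi> x) * f x" .
    qed
  qed
  have "positive_operator (\<lambda>F. 0 - (F - (adj T \<circ> T) F))"
    using S by (simp add: two_hyperexpansive_def operator_le_def T_def)
  moreover have "induces (\<lambda>f x. of_real (\<phi> (x + t) / \<phi> x - 1) * f x) (\<lambda>F. 0 - (F - (adj T \<circ> T) F))"
    by (rule induces_cong[OF induces_diff[OF induces_zero induces_diff[OF induces_id 1]]])
      (simp add: algebra_simps)
  ultimately have "0 \<le> \<phi> (x + t) / \<phi> x - 1"
    using x by (intro positive_multiplicationD[where p = "\<lambda>x. \<phi> (x + t) / \<phi> x - 1"])
      (auto intro!: continuous_intros continuous_on_quotient \<phi> t)
  then show "\<phi> x \<le> \<phi> (x + t)" using pos[OF x] by (simp add: field_simps)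
  let ?q = "\<lambda>x. 2 * (\<phi> (x + t) / \<phi> x) - 1 - \<phi> (x + 2 * t) / \<phi> x"
  have "positive_operator (\<lambda>F. 0 - (F - 2 *\<^sub>R (adj T \<circ> T) F + (adj T ^^ 2 \<circ> T ^^ 2) F))"
    using S by (simp add: two_hyperexpansive_def operator_le_def T_def)
  moreover have "induces (\<lambda>f x. of_real (?q x) * f x)
      (\<lambda>F. 0 - (F - 2 *\<^sub>R (adj T \<circ> T) F + (adj T ^^ 2 \<circ> T ^^ 2) F))"
    by (rule induces_cong[OF induces_diff[OF induces_zero
        induces_add[OF induces_diff[OF induces_id induces_scaleR[OF 1]] 2]]])
      (simp add: algebra_simps)
  moreover have "continuous_on {0..} ?q"
    using t by (intro continuous_intros continuous_on_quotient \<phi>) auto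
  ultimately have "0 \<le> ?q x"
    using x by (intro positive_multiplicationD[where p = ?q]) auto
  moreover have "?q x = (2 * \<phi> (x + t) - \<phi> x - \<phi> (x + 2 * t)) / \<phi> x"
    using pos[OF x] by (simp add: diff_divide_distrib)
  ultimately have "0 \<le> (2 * \<phi> (x + t) - \<phi> x - \<phi> (x + 2 * t)) / \<phi> x"
    by (simp only:)
  then show "\<phi> x + \<phi> (x + 2 * t) \<le> 2 * \<phi> (x + t)"
    using pos[OF x] by (simp add: zero_le_divide_iff)
qed

text \<open>Monotonicity makes the weight at least \<open>1\<close> on \<open>[t, \<infinity>)\<close>, so multiplication by
  \<open>1 / w(x + t)\<^sup>2\<close> is bounded and inverts \<open>S\<^sub>t\<^sup>* S\<^sub>t\<close>. Composing it with \<open>S\<^sub>t\<close> gives the factor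
  \<open>w(x) / w(x)\<^sup>2\<close>. Below \<open>t\<close> the weight is \<open>0\<close>, and \<open>1 / 0 = 0\<close> keeps the reciprocal weight bounded
  and measurable on the whole half-line.\<close>

lemma induces_cauchy_dual:
  assumes \<phi>: "is_symbol \<phi>" and t: "0 \<le> t" and mono: "\<And>x. 0 \<le> x \<Longrightarrow> \<phi> x \<le> \<phi> (x + t)"
  shows "bounded_weight (\<lambda>x. 1 / weight \<phi> t x)"
    and "induces (forward (\<lambda>x. 1 / weight \<phi> t x) t) (cauchy_dual (translation_semigroup \<phi> t))"
proof -
  define T where "T = translation_semigroup \<phi> t"
  define w where "w = weight \<phi> t"
  have pos: "0 < \<phi> x" if "0 \<le> x" for x using \<phi> that by (simp add: is_symbol_def)
  have w: "bounded_weight w" unfolding w_def by (rule bounded_weight_weight[OF \<phi> t])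
  have T: "induces (forward w t) T"
    unfolding w_def T_def by (rule induces_translation_semigroup[OF \<phi> t])
  have w1: "1 \<le> w x" if "t \<le> x" for x
    using mono[of "x - t"] pos[of "x - t"] that by (simp add: w_def weight_def)
  have w0: "w x = 0" if "x < t" for x using that by (simp add: w_def weight_def)
  have c: "continuous_on {t..} (\<lambda>x. 1 / w x)"
  proof (intro continuous_on_divide continuous_on_const ballI)
    show "continuous_on {t..} w" unfolding w_def by (rule weight_continuous[OF \<phi> t])
    show "w x \<noteq> 0" if "x \<in> {t..}" for x using w1[of x] that by auto
  qed
  have "\<bar>1 / w x\<bar> \<le> 1" for x
    using w1[of x] w0[of x] by (cases "t \<le> x") auto
  then show "bounded_weight (\<lambda>x. 1 / weight \<phi> t x)"
    using measurable_half_lineI[OF c] w0 unfolding bounded_weight_def w_def by auto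
  have v: "bounded_weight (\<lambda>x. 1 / (w (x + t))\<^sup>2)"
    unfolding bounded_weight_def
  proof (intro conjI exI[of _ 1] allI impI)
    have "continuous_on {0..} (\<lambda>x. 1 / w (x + t))"
      by (rule continuous_on_compose2[OF c]) (auto intro!: continuous_intros)
    from continuous_on_power[OF this, of 2]
    show "(\<lambda>x. 1 / (w (x + t))\<^sup>2) \<in> borel_measurable (lebesgue_on {0..})"
      by (intro continuous_imp_measurable_on_sets_lebesgue) (simp_all add: power_divide)
    show "\<bar>1 / (w (x + t))\<^sup>2\<bar> \<le> 1" if "0 \<le> x" for x
    proof -
      have "1 \<le> (w (x + t))\<^sup>2" using one_le_power[OF w1[of "x + t"], of 2] that by simp
      moreover from this have "0 < (w (x + t))\<^sup>2" by linarith
      ultimately show ?thesis by (simp add: field_simps)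
    qed
  qed
  \<comment> \<open>A forward translation by \<open>0\<close> is a multiplication on the half-line.\<close>
  define N where "N = (\<lambda>F. abs_L2 (forward (\<lambda>x. 1 / (w (x + t))\<^sup>2) 0 (rep_L2 F)))"
  have N: "induces (forward (\<lambda>x. 1 / (w (x + t))\<^sup>2) 0) N"
    unfolding N_def by (rule induces_forward_rep[OF v]) simp
  note M = induces_adj_comp[OF w t T]
  have nz: "w (x + t) \<noteq> 0" if "0 \<le> x" for x using w1[of "x + t"] that by auto
  have "(adj T \<circ> T) \<circ> N = (\<lambda>F. F)"
    by (rule induces_unique[OF induces_cong[OF induces_comp[OF M N]] induces_id])
      (simp add: forward_def nz)
  moreover have "N \<circ> (adj T \<circ> T) = (\<lambda>F. F)"
    by (rule induces_unique[OF induces_cong[OF induces_comp[OF N M]] induces_id])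
      (simp add: forward_def nz)
  ultimately have "inv (adj T \<circ> T) = N"
    by (intro inv_unique_comp) (auto simp: id_def)
  then have d: "cauchy_dual T = T \<circ> N" by (simp add: cauchy_dual_def)
  have "induces (forward (\<lambda>x. 1 / w x) t) (T \<circ> N)"
  proof (rule induces_cong[OF induces_comp[OF T N]])
    show "(forward w t \<circ> forward (\<lambda>x. 1 / (w (x + t))\<^sup>2) 0) f x = forward (\<lambda>x. 1 / w x) t f x" for f x
      using w1[of x] by (auto simp: forward_def power2_eq_square)
  qed
  then show "induces (forward (\<lambda>x. 1 / weight \<phi> t x) t) (cauchy_dual (translation_semigroup \<phi> t))"
    using d by (simp add: T_def w_def)
qed

theorem proposition4p6:
  fixes \<phi> :: "real \<Rightarrow> real"
  assumes "is_symbol \<phi>"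
    and "C2_half_line \<phi>"
    and "\<forall>t\<ge>0. two_hyperexpansive (translation_semigroup \<phi> t)"
  shows "\<forall>t\<ge>0. hyponormal (cauchy_dual (translation_semigroup \<phi> t)) \<and>
                contraction (cauchy_dual (translation_semigroup \<phi> t))"
proof (intro allI impI)
  fix t :: real assume t: "0 \<le> t"
  note \<phi> = assms(1)
  define D where "D = cauchy_dual (translation_semigroup \<phi> t)"
  define v where "v = (\<lambda>x. 1 / weight \<phi> t x)"
  have pos: "0 < \<phi> x" if "0 \<le> x" for x using \<phi> that by (simp add: is_symbol_def)
  have mono: "\<phi> x \<le> \<phi> (x + t)" and conc: "\<phi> x + \<phi> (x + 2 * t) \<le> 2 * \<phi> (x + t)" if "0 \<le> x" for x
    using two_hyperexpansive_symbol[OF \<phi> t that] assms(3) t by auto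
  have v: "bounded_weight v"
    unfolding v_def by (rule induces_cauchy_dual(1)[OF \<phi> t mono])
  have D: "induces (forward v t) D"
    unfolding v_def D_def by (rule induces_cauchy_dual(2)[OF \<phi> t mono])
  have b: "bounded_operator D" by (rule forward_bounded_operator[OF v t D])
  have sq: "(v (x + t))\<^sup>2 = \<phi> x / \<phi> (x + t)" if "0 \<le> x" for x
    using weight_power2[OF \<phi> t that] by (simp add: v_def power_divide)
  note DD = induces_adj_comp[OF v t D]
  have "positive_operator (\<lambda>F. (F - (adj D \<circ> D) F) - 0)"
  proof (rule positive_multiplicationI)
    show "induces (\<lambda>f x. of_real (1 - (v (x + t))\<^sup>2) * f x) (\<lambda>F. (F - (adj D \<circ> D) F) - 0)"
      by (rule induces_cong[OF induces_diff[OF induces_diff[OF induces_id DD] induces_zero]])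
        (simp add: algebra_simps)
    show "0 \<le> 1 - (v (x + t))\<^sup>2" if "0 \<le> x" for x
      using mono[OF that] pos[of "x + t"] t that by (simp add: sq)
  qed
  then have "contraction D"
    using b by (simp add: contraction_def operator_le_def)
  moreover have "positive_operator (\<lambda>F. ((adj D \<circ> D) F - (D \<circ> adj D) F) - 0)"
  proof (rule positive_multiplicationI)
    let ?p = "\<lambda>x. (v (x + t))\<^sup>2 - (if t \<le> x then (v x)\<^sup>2 else 0)"
    show "induces (\<lambda>f x. of_real (?p x) * f x) (\<lambda>F. ((adj D \<circ> D) F - (D \<circ> adj D) F) - 0)"
      by (rule induces_cong[OF induces_diff[OF induces_diff[OF DD
          induces_comp[OF D induces_adj[OF v t D]]] induces_zero]])
        (simp add: forward_def backward_def algebra_simps power2_eq_square)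
    show "0 \<le> ?p x" if x: "0 \<le> x" for x
    proof (cases "t \<le> x")
      case True
      define a b c where "a = \<phi> (x - t)" and "b = \<phi> x" and "c = \<phi> (x + t)"
      have p: "0 < a" "0 < b" "0 < c"
        using pos[of "x - t"] pos[of x] pos[of "x + t"] True x t by (auto simp: a_def b_def c_def)
      have "a + c \<le> 2 * b"
        using conc[of "x - t"] True by (simp add: a_def b_def c_def add.commute)
      \<comment> \<open>The inequality of arithmetic and geometric means for \<open>a\<close> and \<open>c\<close>.\<close>
      then have "(a + c)\<^sup>2 \<le> (2 * b)\<^sup>2" using p by (intro power_mono) auto
      moreover have "(a + c)\<^sup>2 = (a - c)\<^sup>2 + 4 * (a * c)"
        by (simp add: power2_eq_square algebra_simps)
      ultimately have "4 * (a * c) \<le> (2 * b)\<^sup>2"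
        using zero_le_power2[of "a - c"] by linarith
      then have "a * c \<le> b * b" by (simp add: power2_eq_square)
      then have "a / b \<le> b / c" using p by (simp add: field_simps)
      then show ?thesis
        using sq[OF x] sq[of "x - t"] True by (simp add: a_def b_def c_def)
    qed simp
  qed
  then have "hyponormal D"
    using b by (simp add: hyponormal_def operator_le_def)
  ultimately show "hyponormal (cauchy_dual (translation_semigroup \<phi> t)) \<and>
      contraction (cauchy_dual (translation_semigroup \<phi> t))"
    by (simp add: D_def)
qed

end
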